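(* Let $d \ge 3$ and $n \ge 1$ be integers with $(n,d) \neq (2,3)$, and let $\mathbb{k}$ be an algebraically closed field with $\operatorname{char}\mathbb{k} = 0$ or $\operatorname{char}\mathbb{k} > d$. Let $V_{n,d} \subset \mathbb{k}[x_1,\dots,x_n]$ be the affine space of forms of degree $d$ in $n$ variables. Then the set of central forms is an open and dense subset of $V_{n,d}$ (in the Zariski topology).
   Context: A form of degree $d$ in $n$ variables over $\mathbb{k}$ is an element of $\mathbb{k}[x_1,\dots,x_n]$ that is a $\mathbb{k}$-linear combination of monomials of degree $d$; $V_{n,d}$ is the $\mathbb{k}$-vector space of all such forms, regarded as an affine space. For $f \in V_{n,d}$ with Hessian matrix $H = \left(\frac{\partial^2 f}{\partial x_i \partial x_j}\right)_{1\le i,j\le n}$, the center of $f$ is $$Z(f) := \{X \in \mathbb{k}^{n\times n} \mid (HX)^T = HX\},$$ where the equality is between matrices with polynomial entries. The center always contains the scalar matrices. The form $f$ is called central if $Z(f) \cong \mathbb{k}$, i.e. $Z(f)$ consists exactly of the scalar matrices. *)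

theory Defs
  imports
    "HOL-Library.Poly_Mapping"
    "HOL-Computational_Algebra.Polynomial"
    "HOL-Analysis.Abstract_Topology"
    "Jordan_Normal_Form.Matrix"
begin

section \<open>Polynomials\<close>

text \<open>A monomial is its exponent function of finite support; a polynomial is the finitely
  supported function sending each monomial to its coefficient.\<close>

type_synonym 'i monomial = "'i \<Rightarrow>\<^sub>0 nat"
type_synonym ('i, 'k) mpoly = "'i monomial \<Rightarrow>\<^sub>0 'k"

definition mono_degree :: "'i monomial \<Rightarrow> nat" where
  "mono_degree m = (\<Sum>i\<in>Poly_Mapping.keys m. Poly_Mapping.lookup m i)"

definition eval_mono :: "('i \<Rightarrow> 'k) \<Rightarrow> 'i monomial \<Rightarrow> 'k::comm_semiring_1" where
  "eval_mono a m = (\<Prod>i\<in>Poly_Mapping.keys m. a i ^ Poly_Mapping.lookup m i)"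

definition eval_mpoly :: "('i \<Rightarrow> 'k) \<Rightarrow> ('i, 'k) mpoly \<Rightarrow> 'k::comm_semiring_1" where
  "eval_mpoly a P = (\<Sum>m\<in>Poly_Mapping.keys P. Poly_Mapping.lookup P m * eval_mono a m)"

definition const_mpoly :: "'k \<Rightarrow> ('i, 'k::zero) mpoly" where
  "const_mpoly c = Poly_Mapping.single 0 c"

text \<open>In the following, subtraction of exponents is truncated; this is harmless, since the
  coefficient vanishes for monomials \<open>m\<close> that do not contain the variable \<open>i\<close>.\<close>

definition partial_deriv :: "'i \<Rightarrow> ('i, 'k) mpoly \<Rightarrow> ('i, 'k::comm_semiring_1) mpoly" where
  "partial_deriv i P =
     (\<Sum>m\<in>Poly_Mapping.keys P.
        Poly_Mapping.single (m - Poly_Mapping.single i 1)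
          (of_nat (Poly_Mapping.lookup m i) * Poly_Mapping.lookup P m))"

section \<open>Forms and their centers\<close>

text \<open>The variables \<open>x\<^sub>1, \<dots>, x\<^sub>n\<close> are indexed by \<open>0, \<dots>, n - 1\<close>.\<close>

definition form_monomials :: "nat \<Rightarrow> nat \<Rightarrow> nat monomial set" where
  "form_monomials n d = {m. Poly_Mapping.keys m \<subseteq> {..<n} \<and> mono_degree m = d}"

definition forms :: "nat \<Rightarrow> nat \<Rightarrow> (nat, 'k::zero) mpoly set" where
  "forms n d = {f. Poly_Mapping.keys f \<subseteq> form_monomials n d}"

definition hessian :: "nat \<Rightarrow> (nat, 'k::comm_semiring_1) mpoly \<Rightarrow> (nat, 'k) mpoly mat" where
  "hessian n f = mat n n (\<lambda>(i, j). partial_deriv i (partial_deriv j f))"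

definition form_center :: "nat \<Rightarrow> (nat, 'k::comm_ring_1) mpoly \<Rightarrow> 'k mat set" where
  "form_center n f =
     {X \<in> carrier_mat n n.
        transpose_mat (hessian n f * map_mat const_mpoly X) = hessian n f * map_mat const_mpoly X}"

definition central_form :: "nat \<Rightarrow> (nat, 'k::comm_ring_1) mpoly \<Rightarrow> bool" where
  "central_form n f \<longleftrightarrow> form_center n f = {c \<cdot>\<^sub>m 1\<^sub>m n | c. True}"

section \<open>The Zariski topology on the space of forms\<close>

text \<open>The affine coordinates of a form are its coefficients, so a polynomial function on the
  space of forms is given by a polynomial \<open>P\<close> whose variables are indexed by monomials, evaluated
  at the coefficient function of the form. Variables of \<open>P\<close> whose index is not in
  \<open>form_monomials n d\<close> are evaluated at \<open>0\<close>, so they contribute no further functions.\<close>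

definition form_zero_locus ::
    "nat \<Rightarrow> nat \<Rightarrow> (nat monomial, 'k::comm_semiring_1) mpoly set \<Rightarrow> (nat, 'k) mpoly set" where
  "form_zero_locus n d S =
     {f \<in> forms n d. \<forall>P\<in>S. eval_mpoly (Poly_Mapping.lookup f) P = 0}"

definition zariski_forms :: "nat \<Rightarrow> nat \<Rightarrow> (nat, 'k::comm_semiring_1) mpoly topology" where
  "zariski_forms n d = topology (\<lambda>U. \<exists>S. U = forms n d - form_zero_locus n d S)"

text \<open>The sets used in \<open>zariski_forms\<close> do form a topology.\<close>

lemma eval_mono_superset:
  assumes "finite A" "Poly_Mapping.keys m \<subseteq> A"
  shows "eval_mono a m = (\<Prod>i\<in>A. a i ^ Poly_Mapping.lookup m i)"
  unfolding eval_mono_def using assms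
  by (intro prod.mono_neutral_left) (auto simp: in_keys_iff)

lemma eval_mono_add: "eval_mono a (m + m') = eval_mono a m * eval_mono a m'"
proof -
  let ?A = "Poly_Mapping.keys m \<union> Poly_Mapping.keys m'"
  have "Poly_Mapping.keys (m + m') \<subseteq> ?A" by (rule Poly_Mapping.keys_add)
  then show ?thesis
    by (simp add: eval_mono_superset[where A = ?A] lookup_add power_add prod.distrib)
qed

lemma eval_mpoly_superset:
  assumes "finite A" "Poly_Mapping.keys P \<subseteq> A"
  shows "eval_mpoly a P = (\<Sum>m\<in>A. Poly_Mapping.lookup P m * eval_mono a m)"
  unfolding eval_mpoly_def using assms
  by (intro sum.mono_neutral_left) (auto simp: in_keys_iff)

lemma eval_mpoly_zero [simp]: "eval_mpoly a 0 = 0"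
  by (simp add: eval_mpoly_def)

lemma eval_mpoly_add: "eval_mpoly a (P + Q) = eval_mpoly a P + eval_mpoly a Q"
proof -
  let ?A = "Poly_Mapping.keys P \<union> Poly_Mapping.keys Q"
  have "Poly_Mapping.keys (P + Q) \<subseteq> ?A" by (rule Poly_Mapping.keys_add)
  then show ?thesis
    by (simp add: eval_mpoly_superset[where A = ?A] lookup_add distrib_right sum.distrib)
qed

lemma eval_mpoly_single [simp]: "eval_mpoly a (Poly_Mapping.single m c) = c * eval_mono a m"
  by (simp add: eval_mpoly_def)

lemma eval_mpoly_one [simp]: "eval_mpoly a 1 = 1"
  using eval_mpoly_single[of a 0 1] by (simp add: eval_mono_def del: eval_mpoly_single)

lemma eval_mpoly_sum: "eval_mpoly a (\<Sum>x\<in>A. P x) = (\<Sum>x\<in>A. eval_mpoly a (P x))"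
  by (induction A rule: infinite_finite_induct) (auto simp: eval_mpoly_add)

lemma mpoly_as_sum:
  "P = (\<Sum>m\<in>Poly_Mapping.keys P. Poly_Mapping.single m (Poly_Mapping.lookup P m))"
  by (rule poly_mapping_eqI)
     (auto simp: lookup_sum lookup_single when_def in_keys_iff)

lemma eval_mpoly_mult: "eval_mpoly a (P * Q) = eval_mpoly a P * eval_mpoly a Q"
proof -
  have "P * Q = (\<Sum>m\<in>Poly_Mapping.keys P. \<Sum>m'\<in>Poly_Mapping.keys Q.
      Poly_Mapping.single (m + m') (Poly_Mapping.lookup P m * Poly_Mapping.lookup Q m'))"
    by (subst (1) mpoly_as_sum[of P], subst (1) mpoly_as_sum[of Q])
       (simp add: sum_product mult_single)
  then show ?thesis
    by (simp add: eval_mpoly_sum eval_mono_add)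
       (simp add: eval_mpoly_def sum_product mult_ac)
qed

lemma istopology_zariski_forms:
  "istopology (\<lambda>U. \<exists>S. U =
     (forms n d :: (nat, 'k::{comm_semiring_1, semiring_no_zero_divisors}) mpoly set)
       - form_zero_locus n d S)"
  unfolding istopology_def
proof (intro conjI allI impI; (elim exE)?)
  fix U W :: "(nat, 'k) mpoly set" and S T
  assume U: "U = forms n d - form_zero_locus n d S"
    and W: "W = forms n d - form_zero_locus n d T"
  have "form_zero_locus n d {P * Q | P Q. P \<in> S \<and> Q \<in> T}
      = form_zero_locus n d S \<union> form_zero_locus n d T" (is "?L = ?R")
  proof (intro equalityI subsetI)
    fix f assume f: "f \<in> ?L"
    show "f \<in> ?R"
    proof (rule ccontr)
      assume "f \<notin> ?R"
      with f obtain P Q where PQ: "P \<in> S" "Q \<in> T"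
        and nz: "eval_mpoly (Poly_Mapping.lookup f) P \<noteq> 0"
          "eval_mpoly (Poly_Mapping.lookup f) Q \<noteq> 0"
        unfolding form_zero_locus_def by blast
      from f PQ have "eval_mpoly (Poly_Mapping.lookup f) (P * Q) = 0"
        unfolding form_zero_locus_def by blast
      with nz show False by (simp add: eval_mpoly_mult)
    qed
  qed (auto simp: form_zero_locus_def eval_mpoly_mult)
  then have "U \<inter> W = forms n d - form_zero_locus n d {P * Q | P Q. P \<in> S \<and> Q \<in> T}"
    unfolding U W by blast
  then show "\<exists>S. U \<inter> W = forms n d - form_zero_locus n d S" by blast
next
  fix K :: "(nat, 'k) mpoly set set"
  assume "\<forall>U\<in>K. \<exists>S. U = forms n d - form_zero_locus n d S"
  then obtain S where S: "\<And>U. U \<in> K \<Longrightarrow> U = forms n d - form_zero_locus n d (S U)"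
    by metis
  have "\<Union>K = (\<Union>U\<in>K. forms n d - form_zero_locus n d (S U))"
    using S by auto
  also have "\<dots> = forms n d - form_zero_locus n d (\<Union>U\<in>K. S U)"
    unfolding form_zero_locus_def by auto
  finally show "\<exists>S. \<Union>K = forms n d - form_zero_locus n d S" by blast
qed

lemma openin_zariski_forms:
  fixes U :: "(nat, 'k::{comm_semiring_1, semiring_no_zero_divisors}) mpoly set"
  shows "openin (zariski_forms n d) U \<longleftrightarrow> (\<exists>S. U = forms n d - form_zero_locus n d S)"
  unfolding zariski_forms_def by (subst topology_inverse'[OF istopology_zariski_forms]) (rule refl)

lemma topspace_zariski_forms:
  "topspace (zariski_forms n d
     :: (nat, 'k::{comm_semiring_1, semiring_no_zero_divisors}) mpoly topology) = forms n d"
proof -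
  have "form_zero_locus n d {1} = ({} :: (nat, 'k) mpoly set)"
    by (auto simp: form_zero_locus_def)
  then have "openin (zariski_forms n d) (forms n d :: (nat, 'k) mpoly set)"
    unfolding openin_zariski_forms by (metis Diff_empty)
  moreover have "topspace (zariski_forms n d) \<subseteq> (forms n d :: (nat, 'k) mpoly set)"
    using openin_topspace[of "zariski_forms n d :: (nat, 'k) mpoly topology"]
    unfolding openin_zariski_forms by blast
  ultimately show ?thesis
    by (meson openin_subset subset_antisym)
qed

end

theory Submission
  imports Defs "Jordan_Normal_Form.Determinant"
begin

text \<open>The condition that \<open>X\<close> lies in the center of \<open>f\<close> is a linear system in the entries of \<open>X\<close> whose
  coefficients are linear in those of \<open>f\<close>, and \<open>f\<close> is central iff this system has minimal
  corank; this is an open condition. A nonempty Zariski-open set of forms is dense, since a line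
  joining two forms on which two given polynomials, respectively, do not vanish contains a form on
  which neither vanishes. It remains to exhibit a central form, and
  \<open>x\<^sub>0\<^sup>d\<^sup>-\<^sup>2 (x\<^sub>1\<^sup>2 + \<dots> + x\<^sub>n\<^sub>-\<^sub>1\<^sup>2)\<close> is one.\<close>

section \<open>Polynomial functions\<close>

text \<open>Only the existence of a polynomial matters, so determinants can be handled by closure
  properties of functions, without matrices over a polynomial ring.\<close>

definition poly_function :: "(('i \<Rightarrow> 'k::comm_ring_1) \<Rightarrow> 'k) \<Rightarrow> bool" where
  "poly_function F \<longleftrightarrow> (\<exists>P. \<forall>a. F a = eval_mpoly a P)"

lemma poly_function_const: "poly_function (\<lambda>a. c)"
  unfolding poly_function_def
  by (rule exI[of _ "Poly_Mapping.single 0 c"]) (simp add: eval_mono_def)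

lemma poly_function_coordinate: "poly_function (\<lambda>a. a i)"
  unfolding poly_function_def
  by (rule exI[of _ "Poly_Mapping.single (Poly_Mapping.single i 1) 1"]) (simp add: eval_mono_def)

lemma poly_function_add:
  "poly_function F \<Longrightarrow> poly_function G \<Longrightarrow> poly_function (\<lambda>a. F a + G a)"
  unfolding poly_function_def by (metis eval_mpoly_add)

lemma poly_function_mult:
  "poly_function F \<Longrightarrow> poly_function G \<Longrightarrow> poly_function (\<lambda>a. F a * G a)"
  unfolding poly_function_def by (metis eval_mpoly_mult)

lemma poly_function_diff:
  assumes "poly_function F" "poly_function G"
  shows "poly_function (\<lambda>a. F a - G a)"
proof -
  have "poly_function (\<lambda>a. F a + (- 1) * G a)"
    using assms by (intro poly_function_add poly_function_mult poly_function_const)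
  then show ?thesis by simp
qed

lemma poly_function_sum:
  "(\<And>x. x \<in> A \<Longrightarrow> poly_function (F x)) \<Longrightarrow> poly_function (\<lambda>a. \<Sum>x\<in>A. F x a)"
  by (induction A rule: infinite_finite_induct)
     (simp_all add: poly_function_const poly_function_add)

lemma poly_function_prod:
  "(\<And>x. x \<in> A \<Longrightarrow> poly_function (F x)) \<Longrightarrow> poly_function (\<lambda>a. \<Prod>x\<in>A. F x a)"
  by (induction A rule: infinite_finite_induct)
     (simp_all add: poly_function_const poly_function_mult)

text \<open>By the Leibniz formula the determinant is a signed sum of products of entries.\<close>

lemma poly_function_det:
  assumes "\<And>i j. i < N \<Longrightarrow> j < N \<Longrightarrow> poly_function (\<lambda>a. M a i j)"
  shows "poly_function (\<lambda>a. det (mat N N (\<lambda>(i, j). M a i j)))"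
proof -
  have "det (mat N N (\<lambda>(i, j). M a i j))
      = (\<Sum>p | p permutes {0..<N}. signof p * (\<Prod>i = 0..<N. M a i (p i)))" for a
    by (subst det_def'[of _ N])
       (auto intro!: sum.cong prod.cong arg_cong2[where f = "(*)"] simp: permutes_in_image)
  moreover have "poly_function
      (\<lambda>a. \<Sum>p | p permutes {0..<N}. signof p * (\<Prod>i = 0..<N. M a i (p i)))"
    by (intro poly_function_sum poly_function_mult poly_function_const poly_function_prod assms)
       (auto simp: permutes_in_image)
  ultimately show ?thesis by simp
qed

text \<open>The univariate polynomial arises by substituting \<open>[:a i, b i:]\<close> for each
  variable \<open>i\<close>.\<close>

lemma eval_mpoly_on_line:
  fixes a b :: "'i \<Rightarrow> 'k::comm_ring_1"
  shows "\<exists>p. \<forall>t. eval_mpoly (\<lambda>i. a i + t * b i) P = poly p t"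
  by (rule exI[of _ "\<Sum>m\<in>Poly_Mapping.keys P. Polynomial.smult (Poly_Mapping.lookup P m)
        (\<Prod>i\<in>Poly_Mapping.keys m. [:a i, b i:] ^ Poly_Mapping.lookup m i)"])
     (simp add: eval_mpoly_def eval_mono_def poly_sum poly_prod)

text \<open>Over a finite field, one plus the product of all \<open>[:- a, 1:]\<close> would have
  positive degree and no root.\<close>

lemma infinite_UNIV_alg_closed_field: "infinite (UNIV :: 'k::alg_closed_field set)"
proof
  assume fin: "finite (UNIV :: 'k set)"
  let ?q = "\<Prod>a\<in>(UNIV :: 'k set). [:- a, 1:]"
  have "degree ?q = card (UNIV :: 'k set)"
    by (subst degree_prod_eq_sum_degree) auto
  moreover have "card (UNIV :: 'k set) > 0"
    using fin by (simp add: finite_UNIV_card_ge_0)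
  ultimately have "degree (?q + 1) > 0"
    by (simp add: degree_add_eq_left)
  then obtain x where "poly (?q + 1) x = 0"
    using alg_closed_imp_poly_has_root by blast
  moreover have "poly ?q x = 0"
    using fin by (auto simp: poly_prod)
  ultimately show False by simp
qed

section \<open>Families of linear functionals\<close>

lemma functional_in_span:
  fixes y :: "'b \<Rightarrow> 'k::field"
  assumes "finite S" "finite B"
    and "\<And>x. (\<And>s. s \<in> S \<Longrightarrow> (\<Sum>b\<in>B. w s b * x b) = 0) \<Longrightarrow> (\<Sum>b\<in>B. y b * x b) = 0"
  shows "\<exists>c. \<forall>b\<in>B. y b = (\<Sum>s\<in>S. c s * w s b)"
  using assms(1,3)
proof (induction S arbitrary: y rule: finite_induct)
  case empty
  have "y b = 0" if "b \<in> B" for b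
    using empty[of "\<lambda>b'. if b' = b then 1 else 0"] that assms(2)
    by (simp add: if_distrib cong: if_cong)
  then show ?case by simp
next
  case (insert s S)
  show ?case
  proof (cases "\<exists>x. (\<forall>s\<in>S. (\<Sum>b\<in>B. w s b * x b) = 0) \<and> (\<Sum>b\<in>B. w s b * x b) \<noteq> 0")
    case False
    then have "\<exists>c. \<forall>b\<in>B. y b = (\<Sum>s\<in>S. c s * w s b)"
      using insert.prems by (intro insert.IH) blast
    then obtain c where "\<forall>b\<in>B. y b = (\<Sum>s\<in>S. c s * w s b)" by blast
    then have "\<forall>b\<in>B. y b = (\<Sum>t\<in>insert s S. (c(s := 0)) t * w t b)"
      using insert.hyps by (auto intro!: sum.cong)
    then show ?thesis by blast
  next
    case True
    then obtain z where z: "\<And>t. t \<in> S \<Longrightarrow> (\<Sum>b\<in>B. w t b * z b) = 0"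
      and "(\<Sum>b\<in>B. w s b * z b) \<noteq> 0" by blast
    \<comment> \<open>With this \<open>r\<close>, the functional \<open>y - r * w s\<close> vanishes
      at \<open>z\<close>.\<close>
    define r where "r = (\<Sum>b\<in>B. y b * z b) / (\<Sum>b\<in>B. w s b * z b)"
    have r: "r * (\<Sum>b\<in>B. w s b * z b) = (\<Sum>b\<in>B. y b * z b)"
      using \<open>(\<Sum>b\<in>B. w s b * z b) \<noteq> 0\<close> by (simp add: r_def)
    have "\<exists>c. \<forall>b\<in>B. y b - r * w s b = (\<Sum>s\<in>S. c s * w s b)"
    proof (rule insert.IH)
      fix x assume x: "\<And>t. t \<in> S \<Longrightarrow> (\<Sum>b\<in>B. w t b * x b) = 0"
      \<comment> \<open>Subtracting \<open>e\<close> times \<open>z\<close> moves \<open>x\<close>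
        into the kernel of \<open>w s\<close> without leaving the kernels for \<open>S\<close>;
        there the assumption on \<open>y\<close> applies.\<close>
      define e where "e = (\<Sum>b\<in>B. w s b * x b) / (\<Sum>b\<in>B. w s b * z b)"
      have e: "e * (\<Sum>b\<in>B. w s b * z b) = (\<Sum>b\<in>B. w s b * x b)"
        using \<open>(\<Sum>b\<in>B. w s b * z b) \<noteq> 0\<close> by (simp add: e_def)
      have split: "(\<Sum>b\<in>B. v b * (x b - e * z b)) = (\<Sum>b\<in>B. v b * x b) - e * (\<Sum>b\<in>B. v b * z b)"
        for v
        by (simp add: algebra_simps sum_subtractf sum_distrib_left)
      have "(\<Sum>b\<in>B. y b * (x b - e * z b)) = 0"
      proof (rule insert.prems)
        fix t assume "t \<in> insert s S"
        then show "(\<Sum>b\<in>B. w t b * (x b - e * z b)) = 0"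
          unfolding split using x z e by auto
      qed
      then have "(\<Sum>b\<in>B. y b * x b) = e * (r * (\<Sum>b\<in>B. w s b * z b))"
        unfolding split r by simp
      also have "\<dots> = r * (\<Sum>b\<in>B. w s b * x b)"
        by (simp flip: e)
      finally show "(\<Sum>b\<in>B. (y b - r * w s b) * x b) = 0"
        by (simp add: algebra_simps sum_subtractf sum_distrib_left)
    qed
    then obtain c where c: "\<forall>b\<in>B. y b - r * w s b = (\<Sum>s\<in>S. c s * w s b)" by blast
    have "y b = (\<Sum>t\<in>insert s S. (c(s := r)) t * w t b)" if "b \<in> B" for b
    proof -
      have "(\<Sum>t\<in>S. (c(s := r)) t * w t b) = (\<Sum>t\<in>S. c t * w t b)"
        using insert.hyps by (auto intro!: sum.cong)
      with c that insert.hyps show ?thesis by (simp add: algebra_simps)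
    qed
    then show ?thesis by blast
  qed
qed

lemma det_nonzero_kernel_trivial:
  fixes M :: "nat \<Rightarrow> nat \<Rightarrow> 'k::field"
  assumes "det (mat N N (\<lambda>(i, j). M i j)) \<noteq> 0"
    and "\<And>i. i < N \<Longrightarrow> (\<Sum>j<N. M i j * x j) = 0" and "i < N"
  shows "x i = 0"
proof -
  let ?A = "mat N N (\<lambda>(i, j). M i j)"
  have "?A *\<^sub>v vec N x = 0\<^sub>v N"
    using assms(2) by (intro eq_vecI) (auto simp: scalar_prod_def atLeast0LessThan)
  then have "vec N x = 0\<^sub>v N"
    using assms(1) det_0_iff_vec_prod_zero[of ?A N] by (metis mat_carrier vec_carrier)
  then have "vec N x $ i = 0" using \<open>i < N\<close> by simp
  then show ?thesis using \<open>i < N\<close> by simp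
qed

text \<open>\<open>P\<close> is the determinant of the square system, with \<open>B\<close> numbered
  to obtain a matrix. At \<open>a0\<close> this matrix is the identity.\<close>

lemma polynomial_certificate_for_trivial_kernel:
  fixes G :: "('i \<Rightarrow> 'k::field) \<Rightarrow> 'b \<Rightarrow> 'b \<Rightarrow> 'k"
  assumes fin: "finite B"
    and poly: "\<And>b b'. b \<in> B \<Longrightarrow> b' \<in> B \<Longrightarrow> poly_function (\<lambda>a. G a b b')"
    and G0: "\<And>b b'. b \<in> B \<Longrightarrow> b' \<in> B \<Longrightarrow> G a0 b b' = (if b = b' then 1 else 0)"
  shows "\<exists>P. eval_mpoly a0 P \<noteq> 0 \<and>
    (\<forall>a x. eval_mpoly a P \<noteq> 0 \<longrightarrow> (\<forall>b\<in>B. (\<Sum>b'\<in>B. G a b b' * x b') = 0) \<longrightarrow> (\<forall>b\<in>B. x b = 0))"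
proof -
  obtain h where h: "bij_betw h {0..<card B} B"
    using ex_bij_betw_nat_finite[OF fin] by blast
  let ?N = "card B"
  let ?M = "\<lambda>a. mat ?N ?N (\<lambda>(i, j). G a (h i) (h j))"
  have hB: "h i \<in> B" if "i < ?N" for i
    using h that by (auto simp: bij_betw_def)
  have inj: "h i = h j \<longleftrightarrow> i = j" if "i < ?N" "j < ?N" for i j
    using h that by (auto simp: bij_betw_def inj_on_def)
  have "poly_function (\<lambda>a. det (?M a))"
    using poly hB by (intro poly_function_det) auto
  then obtain P where P: "\<And>a. det (?M a) = eval_mpoly a P"
    unfolding poly_function_def by blast
  have "?M a0 = 1\<^sub>m ?N"
    using G0 hB inj by (intro eq_matI) auto
  then have "eval_mpoly a0 P \<noteq> 0"
    using P[of a0] by simp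
  moreover have "x b = 0"
    if nz: "eval_mpoly a P \<noteq> 0" and eqs: "\<forall>b\<in>B. (\<Sum>b'\<in>B. G a b b' * x b') = 0" and "b \<in> B"
    for a x b
  proof -
    obtain i where i: "i < ?N" "b = h i"
      using h \<open>b \<in> B\<close> by (metis atLeastLessThan_iff bij_betw_imp_surj_on imageE)
    have "(x \<circ> h) i = 0"
    proof (rule det_nonzero_kernel_trivial[where M = "\<lambda>i j. G a (h i) (h j)"])
      fix i assume "i < ?N"
      then have "0 = (\<Sum>b'\<in>B. G a (h i) b' * x b')"
        using eqs hB by simp
      also have "\<dots> = (\<Sum>j<?N. G a (h i) (h j) * (x \<circ> h) j)"
        by (subst sum.reindex_bij_betw[OF h, symmetric]) (simp add: atLeast0LessThan)
      finally show "(\<Sum>j<?N. G a (h i) (h j) * (x \<circ> h) j) = 0" by simp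
    qed (use nz P i in auto)
    then show ?thesis using i by simp
  qed
  ultimately show ?thesis by blast
qed

section \<open>The center as the solution set of a linear system\<close>

lemma lookup_mult_const_mpoly:
  fixes P :: "('i, 'k::comm_ring_1) mpoly"
  shows "Poly_Mapping.lookup (P * const_mpoly c) m = Poly_Mapping.lookup P m * c"
proof -
  have "P * const_mpoly c
      = (\<Sum>m\<in>Poly_Mapping.keys P. Poly_Mapping.single m (Poly_Mapping.lookup P m * c))"
    by (subst (1) mpoly_as_sum[of P]) (simp add: sum_distrib_right mult_single const_mpoly_def)
  then show ?thesis
    by (auto simp: lookup_sum lookup_single when_def in_keys_iff)
qed

lemma lookup_partial_deriv:
  fixes P :: "('i, 'k::comm_ring_1) mpoly"
  shows "Poly_Mapping.lookup (partial_deriv i P) m =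
    of_nat (Poly_Mapping.lookup m i + 1) * Poly_Mapping.lookup P (m + Poly_Mapping.single i 1)"
proof -
  let ?e = "Poly_Mapping.single i (1::nat)"
  \<comment> \<open>Truncated subtraction can be undone only if \<open>m'\<close> contains the
    variable; the remaining terms carry the factor 0.\<close>
  have shift: "m' - ?e = m \<longleftrightarrow> m' = m + ?e" if "Poly_Mapping.lookup m' i \<noteq> 0" for m'
  proof
    assume eq: "m' - ?e = m"
    show "m' = m + ?e"
    proof (rule poly_mapping_eqI)
      fix k
      show "Poly_Mapping.lookup m' k = Poly_Mapping.lookup (m + ?e) k"
        using that unfolding eq[symmetric]
        by (auto simp: lookup_add lookup_minus lookup_single when_def)
    qed
  qed simp
  have "Poly_Mapping.lookup (partial_deriv i P) m = (\<Sum>m'\<in>Poly_Mapping.keys P.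
      if m' - ?e = m then of_nat (Poly_Mapping.lookup m' i) * Poly_Mapping.lookup P m' else 0)"
    by (simp add: partial_deriv_def lookup_sum lookup_single when_def)
  also have "\<dots> = (\<Sum>m'\<in>Poly_Mapping.keys P.
      if m' = m + ?e then of_nat (Poly_Mapping.lookup m' i) * Poly_Mapping.lookup P m' else 0)"
  proof (rule sum.cong)
    fix m'
    show "(if m' - ?e = m then of_nat (Poly_Mapping.lookup m' i) * Poly_Mapping.lookup P m' else 0)
        = (if m' = m + ?e then of_nat (Poly_Mapping.lookup m' i) * Poly_Mapping.lookup P m' else 0)"
      using shift[of m'] by (cases "Poly_Mapping.lookup m' i = 0") auto
  qed simp
  also have "\<dots> = of_nat (Poly_Mapping.lookup m i + 1) * Poly_Mapping.lookup P (m + ?e)"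
    by (auto simp: lookup_add in_keys_iff)
  finally show ?thesis .
qed

text \<open>At the coefficients of \<open>f\<close>, this is the coefficient of \<open>m\<close> in
  the Hessian entry \<open>(i, k)\<close>. Arbitrary functions \<open>a\<close> are allowed so that
  polynomial dependence on \<open>a\<close> can be expressed.\<close>

definition hess_coeff ::
    "(nat monomial \<Rightarrow> 'k::comm_ring_1) \<Rightarrow> nat monomial \<Rightarrow> nat \<Rightarrow> nat \<Rightarrow> 'k" where
  "hess_coeff a m i k =
     of_nat ((Poly_Mapping.lookup m i + 1) *
       (Poly_Mapping.lookup (m + Poly_Mapping.single i 1) k + 1)) *
     a (m + Poly_Mapping.single i 1 + Poly_Mapping.single k 1)"

lemma lookup_hessian:
  "Poly_Mapping.lookup (partial_deriv i (partial_deriv k f)) m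
     = hess_coeff (Poly_Mapping.lookup f) m i k"
  by (simp only: lookup_partial_deriv hess_coeff_def of_nat_mult mult.assoc)

lemma hess_coeff_sym: "hess_coeff a m i k = hess_coeff a m k i"
  by (simp add: hess_coeff_def lookup_add lookup_single when_def add_ac mult_ac)

lemma poly_function_hess_coeff: "poly_function (\<lambda>a. hess_coeff a m i k)"
  unfolding hess_coeff_def by (intro poly_function_mult poly_function_const poly_function_coordinate)

text \<open>Comparing coefficients turns symmetry of a polynomial matrix into scalar linear
  equations for the entries of \<open>X\<close>.\<close>

lemma mem_form_center_iff:
  "X \<in> form_center n f \<longleftrightarrow> X \<in> carrier_mat n n \<and>
    (\<forall>i<n. \<forall>j<n. \<forall>m. (\<Sum>k<n. hess_coeff (Poly_Mapping.lookup f) m i k * X $$ (k, j))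
                   = (\<Sum>k<n. hess_coeff (Poly_Mapping.lookup f) m j k * X $$ (k, i)))"
proof (cases "X \<in> carrier_mat n n")
  case True
  define Y where "Y = hessian n f * map_mat const_mpoly X"
  have entry: "Poly_Mapping.lookup (Y $$ (i, j)) m
      = (\<Sum>k<n. hess_coeff (Poly_Mapping.lookup f) m i k * X $$ (k, j))" if "i < n" "j < n" for i j m
    using that True
    by (simp add: Y_def hessian_def scalar_prod_def lookup_sum lookup_mult_const_mpoly
        lookup_hessian atLeast0LessThan)
  have dims: "dim_row Y = n" "dim_col Y = n"
    using True by (auto simp: Y_def hessian_def)
  have "transpose_mat Y = Y \<longleftrightarrow> (\<forall>i<n. \<forall>j<n. Y $$ (i, j) = Y $$ (j, i))"
  proof
    assume "transpose_mat Y = Y"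
    then show "\<forall>i<n. \<forall>j<n. Y $$ (i, j) = Y $$ (j, i)"
      using dims by (metis index_transpose_mat(1))
  next
    assume "\<forall>i<n. \<forall>j<n. Y $$ (i, j) = Y $$ (j, i)"
    then show "transpose_mat Y = Y"
      using dims by (intro eq_matI) auto
  qed
  also have "\<dots> \<longleftrightarrow> (\<forall>i<n. \<forall>j<n. \<forall>m.
      Poly_Mapping.lookup (Y $$ (i, j)) m = Poly_Mapping.lookup (Y $$ (j, i)) m)"
    by (metis poly_mapping_eqI)
  finally show ?thesis
    using True entry by (simp add: form_center_def flip: Y_def)
qed (simp add: form_center_def)

text \<open>The product is a multiple of the Hessian, and mixed partial derivatives commute.\<close>

lemma scalar_mat_in_form_center: "c \<cdot>\<^sub>m 1\<^sub>m n \<in> form_center n f"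
proof -
  have "(\<Sum>k<n. hess_coeff (Poly_Mapping.lookup f) m i k * (c \<cdot>\<^sub>m 1\<^sub>m n) $$ (k, j))
      = hess_coeff (Poly_Mapping.lookup f) m i j * c" if "j < n" for i j m
  proof -
    have "(\<Sum>k<n. hess_coeff (Poly_Mapping.lookup f) m i k * (c \<cdot>\<^sub>m 1\<^sub>m n) $$ (k, j))
        = (\<Sum>k<n. if k = j then hess_coeff (Poly_Mapping.lookup f) m i j * c else 0)"
      using that by (intro sum.cong) auto
    with that show ?thesis by simp
  qed
  then show ?thesis
    by (auto simp: mem_form_center_iff hess_coeff_sym)
qed

text \<open>One inclusion is automatic, so centrality means that certain linear functionals vanish
  on the center. The entry \<open>(0, 0)\<close>, present since \<open>n \<ge> 1\<close>, is the
  reference scalar.\<close>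

lemma central_form_iff:
  assumes "n \<ge> 1"
  shows "central_form n f \<longleftrightarrow> (\<forall>X \<in> form_center n f. \<forall>i<n. \<forall>j<n.
    X $$ (i, j) = (if i = j then X $$ (0, 0) else 0))"
proof
  assume c: "central_form n f"
  show "\<forall>X \<in> form_center n f. \<forall>i<n. \<forall>j<n. X $$ (i, j) = (if i = j then X $$ (0, 0) else 0)"
    using c assms by (auto simp: central_form_def)
next
  assume *: "\<forall>X \<in> form_center n f. \<forall>i<n. \<forall>j<n. X $$ (i, j) = (if i = j then X $$ (0, 0) else 0)"
  have "X = X $$ (0, 0) \<cdot>\<^sub>m 1\<^sub>m n" if X: "X \<in> form_center n f" for X
  proof (rule eq_matI)
    fix i j assume "i < dim_row (X $$ (0, 0) \<cdot>\<^sub>m 1\<^sub>m n)" "j < dim_col (X $$ (0, 0) \<cdot>\<^sub>m 1\<^sub>m n)"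
    then have ij: "i < n" "j < n" by simp_all
    with * X have "X $$ (i, j) = (if i = j then X $$ (0, 0) else 0)" by blast
    with ij show "X $$ (i, j) = (X $$ (0, 0) \<cdot>\<^sub>m 1\<^sub>m n) $$ (i, j)" by simp
  qed (use X in \<open>auto simp: form_center_def\<close>)
  then show "central_form n f"
    unfolding central_form_def using scalar_mat_in_form_center by blast
qed

section \<open>Openness\<close>

text \<open>The triple \<open>(i, j, m)\<close> indexes one equation, the coefficient of
  \<open>m\<close> in the difference of the entries \<open>(i, j)\<close> and \<open>(j, i)\<close>
  of the Hessian times \<open>X\<close>; \<open>b\<close> is the position of an unknown entry of
  \<open>X\<close>.\<close>

definition symmetry_coeff ::
    "(nat monomial \<Rightarrow> 'k::comm_ring_1) \<Rightarrow> nat \<times> nat \<times> nat monomial \<Rightarrow> nat \<times> nat \<Rightarrow> 'k" where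
  "symmetry_coeff a s b = (case s of (i, j, m) \<Rightarrow>
     (if snd b = j then hess_coeff a m i (fst b) else 0)
     - (if snd b = i then hess_coeff a m j (fst b) else 0))"

lemma sum_symmetry_coeff:
  assumes "i < n" "j < n"
  shows "(\<Sum>b\<in>{..<n} \<times> {..<n}. symmetry_coeff a (i, j, m) b * x b)
    = (\<Sum>k<n. hess_coeff a m i k * x (k, j)) - (\<Sum>k<n. hess_coeff a m j k * x (k, i))"
proof -
  have "(\<Sum>b\<in>{..<n} \<times> {..<n}. symmetry_coeff a (i, j, m) b * x b)
      = (\<Sum>k<n. \<Sum>l<n. (if l = j then hess_coeff a m i k * x (k, l) else 0)
          - (if l = i then hess_coeff a m j k * x (k, l) else 0))"
    unfolding sum.cartesian_product
    by (intro sum.cong) (auto simp: symmetry_coeff_def algebra_simps)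
  then show ?thesis
    using assms by (simp add: sum_subtractf)
qed

lemma poly_function_symmetry_coeff: "poly_function (\<lambda>a. symmetry_coeff a s b)"
proof (cases s)
  case (fields i j m)
  have "poly_function (\<lambda>a. if c then hess_coeff a m u v else 0)" for c and u v
    by (cases c) (simp_all add: poly_function_hess_coeff poly_function_const)
  then show ?thesis
    unfolding symmetry_coeff_def fields prod.case by (intro poly_function_diff)
qed

text \<open>At a central form, each functional \<open>X\<^sub>i\<^sub>j - \<delta>\<^sub>i\<^sub>j X\<^sub>0\<^sub>0\<close> is a linear combination of the equations
  of the center. Keeping the coefficients of these combinations fixed while the form varies, one
  obtains a square system whose determinant is the required polynomial.\<close>

lemma central_form_neighbourhood:
  fixes f0 :: "(nat, 'k::field) mpoly"
  assumes n: "n \<ge> 1" and central: "central_form n f0"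
  shows "\<exists>P. eval_mpoly (Poly_Mapping.lookup f0) P \<noteq> 0 \<and>
    (\<forall>f. eval_mpoly (Poly_Mapping.lookup f) P \<noteq> 0 \<longrightarrow> central_form n f)"
proof -
  let ?a0 = "Poly_Mapping.lookup f0"
  let ?B = "{..<n} \<times> {..<n}"
  let ?keys = "\<Union>i<n. \<Union>k<n. Poly_Mapping.keys (partial_deriv i (partial_deriv k f0))"
  \<comment> \<open>Finitely many equations suffice at \<open>f0\<close>, since no other monomial
    occurs in its Hessian. For other \<open>f\<close> it is only needed that the center satisfies
    these equations.\<close>
  define S where "S = {..<n} \<times> {..<n} \<times> ?keys"
  have finS: "finite S" by (auto simp: S_def)
  have zero: "hess_coeff ?a0 m i k = 0" if "m \<notin> ?keys" "i < n" "k < n" for m i k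
  proof -
    have "m \<notin> Poly_Mapping.keys (partial_deriv i (partial_deriv k f0))"
      using that by blast
    then show ?thesis by (simp add: in_keys_iff lookup_hessian)
  qed
  \<comment> \<open>The coefficient vector of the functional attached to \<open>p\<close>; it is
    zero for \<open>p = (0, 0)\<close>.\<close>
  define y :: "nat \<times> nat \<Rightarrow> nat \<times> nat \<Rightarrow> 'k" where
    "y p b = (if b = p then 1 else 0) - (if fst p = snd p \<and> b = (0, 0) then 1 else 0)" for p b
  have y_sum: "(\<Sum>b\<in>?B. y p b * x b) = x p - (if fst p = snd p then x (0, 0) else 0)"
    if "p \<in> ?B" for p x
  proof -
    have "(\<Sum>b\<in>?B. y p b * x b) = (\<Sum>b\<in>?B. if b = p then x b else 0)
        - (\<Sum>b\<in>?B. if b = (0, 0) then (if fst p = snd p then x b else 0) else 0)"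
      unfolding sum_subtractf[symmetric] by (intro sum.cong) (auto simp: y_def)
    also have "\<dots> = x p - (if fst p = snd p then x (0, 0) else 0)"
      using that n by (subst (1 2) sum.delta) auto
    finally show ?thesis .
  qed
  have "\<forall>p\<in>?B. \<exists>c. \<forall>b\<in>?B. y p b = (\<Sum>s\<in>S. c s * symmetry_coeff ?a0 s b)"
  proof (intro ballI functional_in_span[OF finS])
    fix p x
    assume p: "p \<in> ?B" and x: "\<And>s. s \<in> S \<Longrightarrow> (\<Sum>b\<in>?B. symmetry_coeff ?a0 s b * x b) = 0"
    have "mat n n x \<in> form_center n f0"
      unfolding mem_form_center_iff
    proof (intro conjI allI impI)
      fix i j m assume ij: "i < n" "j < n"
      have "(\<Sum>k<n. hess_coeff ?a0 m i k * x (k, j)) = (\<Sum>k<n. hess_coeff ?a0 m j k * x (k, i))"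
      proof (cases "m \<in> ?keys")
        case True
        then have "(i, j, m) \<in> S" using ij by (simp add: S_def)
        from x[OF this] show ?thesis by (simp add: sum_symmetry_coeff[OF ij])
      next
        case False
        then show ?thesis using ij zero by simp
      qed
      with ij show "(\<Sum>k<n. hess_coeff ?a0 m i k * mat n n x $$ (k, j))
          = (\<Sum>k<n. hess_coeff ?a0 m j k * mat n n x $$ (k, i))" by simp
    qed simp
    then have "\<forall>i<n. \<forall>j<n. mat n n x $$ (i, j) = (if i = j then mat n n x $$ (0, 0) else 0)"
      using central unfolding central_form_iff[OF n] by blast
    moreover obtain i j where ij: "p = (i, j)" "i < n" "j < n"
      using p by auto
    ultimately have "mat n n x $$ (i, j) = (if i = j then mat n n x $$ (0, 0) else 0)"
      by blast
    then have "x p = (if fst p = snd p then x (0, 0) else 0)"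
      using ij n by simp
    then show "(\<Sum>b\<in>?B. y p b * x b) = 0"
      by (simp only: y_sum[OF p] diff_self)
  qed simp
  from bchoice[OF this] obtain c
    where c: "\<forall>p\<in>?B. \<forall>b\<in>?B. y p b = (\<Sum>s\<in>S. c p s * symmetry_coeff ?a0 s b)" ..
  \<comment> \<open>The added term cancels the subtracted one in \<open>y\<close>, so at
    \<open>f0\<close> this is the identity matrix, including the row \<open>(0, 0)\<close>.\<close>
  define G where "G a p b = (\<Sum>s\<in>S. c p s * symmetry_coeff a s b)
    + (if fst p = snd p \<and> b = (0, 0) then 1 else 0)" for a p b
  have "\<exists>P. eval_mpoly ?a0 P \<noteq> 0 \<and>
    (\<forall>a x. eval_mpoly a P \<noteq> 0 \<longrightarrow> (\<forall>b\<in>?B. (\<Sum>b'\<in>?B. G a b b' * x b') = 0) \<longrightarrow> (\<forall>b\<in>?B. x b = 0))"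
  proof (rule polynomial_certificate_for_trivial_kernel)
    show "poly_function (\<lambda>a. G a p b)" for p b
      unfolding G_def
      by (intro poly_function_add poly_function_sum poly_function_mult poly_function_const
          poly_function_symmetry_coeff)
    show "G ?a0 p b = (if p = b then 1 else 0)" if "p \<in> ?B" "b \<in> ?B" for p b
      unfolding G_def c[rule_format, OF that, symmetric] by (auto simp: y_def)
  qed simp
  then obtain P where P0: "eval_mpoly ?a0 P \<noteq> 0"
    and P: "\<forall>a x. eval_mpoly a P \<noteq> 0 \<longrightarrow> (\<forall>b\<in>?B. (\<Sum>b'\<in>?B. G a b b' * x b') = 0) \<longrightarrow>
        (\<forall>b\<in>?B. x b = 0)" by (elim exE conjE)
  have "central_form n f" if nz: "eval_mpoly (Poly_Mapping.lookup f) P \<noteq> 0" for f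
    unfolding central_form_iff[OF n]
  proof (intro ballI allI impI)
    fix X i j assume X: "X \<in> form_center n f" and ij: "i < n" "j < n"
    let ?a = "Poly_Mapping.lookup f"
    \<comment> \<open>Removing the scalar part of \<open>X\<close> preserves the equations, by
      symmetry of the Hessian, and gives \<open>x (0, 0) = 0\<close>, so the added term of
      \<open>G\<close> contributes nothing.\<close>
    define x where "x b = X $$ b - (if fst b = snd b then X $$ (0, 0) else 0)" for b
    have "x (i, j) = 0"
    proof (rule P[rule_format, OF nz])
      fix p assume p: "p \<in> ?B"
      have eqs: "(\<Sum>b\<in>?B. symmetry_coeff ?a s b * x b) = 0" if "s \<in> S" for s
      proof -
        obtain i j m where s: "s = (i, j, m)" and ij: "i < n" "j < n"
          using \<open>s \<in> S\<close> by (auto simp: S_def)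
        have "(\<Sum>k<n. hess_coeff ?a m u k * x (k, v))
            = (\<Sum>k<n. hess_coeff ?a m u k * X $$ (k, v)) - hess_coeff ?a m u v * X $$ (0, 0)"
          if "v < n" for u v
        proof -
          have "(\<Sum>k<n. hess_coeff ?a m u k * x (k, v))
              = (\<Sum>k<n. hess_coeff ?a m u k * X $$ (k, v)
                  - (if k = v then hess_coeff ?a m u v * X $$ (0, 0) else 0))"
            by (intro sum.cong) (auto simp: x_def algebra_simps)
          with that show ?thesis by (simp add: sum_subtractf)
        qed
        moreover have "(\<Sum>k<n. hess_coeff ?a m i k * X $$ (k, j))
            = (\<Sum>k<n. hess_coeff ?a m j k * X $$ (k, i))"
          using X ij unfolding mem_form_center_iff by blast
        ultimately show ?thesis
          unfolding s sum_symmetry_coeff[OF ij] using ij hess_coeff_sym[of ?a m i j] by simp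
      qed
      have "(\<Sum>b\<in>?B. G ?a p b * x b) = (\<Sum>b\<in>?B. \<Sum>s\<in>S. c p s * (symmetry_coeff ?a s b * x b))
          + (\<Sum>b\<in>?B. if b = (0, 0) then (if fst p = snd p then x b else 0) else 0)"
        unfolding sum.distrib[symmetric] G_def
        by (intro sum.cong) (auto simp: distrib_right sum_distrib_right mult.assoc)
      also have "(\<Sum>b\<in>?B. if b = (0, 0) then (if fst p = snd p then x b else 0) else 0) = 0"
        by (intro sum.neutral) (auto simp: x_def)
      also have "(\<Sum>b\<in>?B. \<Sum>s\<in>S. c p s * (symmetry_coeff ?a s b * x b))
          = (\<Sum>s\<in>S. c p s * (\<Sum>b\<in>?B. symmetry_coeff ?a s b * x b))"
        by (subst sum.swap) (simp add: sum_distrib_left)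
      finally show "(\<Sum>b\<in>?B. G ?a p b * x b) = 0"
        using eqs by simp
    qed (use ij in simp)
    then show "X $$ (i, j) = (if i = j then X $$ (0, 0) else 0)"
      by (simp add: x_def)
  qed
  with P0 show ?thesis by blast
qed

section \<open>A central form\<close>

definition star_monomial :: "nat \<Rightarrow> nat \<Rightarrow> nat monomial" where
  "star_monomial d i = Poly_Mapping.single 0 (d - 2) + Poly_Mapping.single i 2"

text \<open>For \<open>n = 1\<close> the sum is empty and the form is 0; it is still central, as
  every 1 by 1 matrix is scalar.\<close>

definition star_form :: "nat \<Rightarrow> nat \<Rightarrow> (nat, 'k::comm_ring_1) mpoly" where
  "star_form n d = (\<Sum>i\<in>{1..<n}. Poly_Mapping.single (star_monomial d i) 1)"

lemma single_eq_iff: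
  assumes "(c::'b::zero) \<noteq> 0"
  shows "Poly_Mapping.single i c = Poly_Mapping.single j c \<longleftrightarrow> i = j"
  using assms by (metis lookup_single_eq lookup_single_not_eq)

lemma star_monomial_eq_iff:
  "star_monomial d i = star_monomial d j \<longleftrightarrow> i = j"
  by (simp add: star_monomial_def single_eq_iff)

lemma lookup_star_form:
  "Poly_Mapping.lookup (star_form n d) m = (if \<exists>l\<in>{1..<n}. m = star_monomial d l then 1 else 0)"
proof (cases "\<exists>l\<in>{1..<n}. m = star_monomial d l")
  case True
  then obtain l where l: "l \<in> {1..<n}" "m = star_monomial d l" by blast
  then show ?thesis
    by (auto simp: star_form_def lookup_sum lookup_single when_def star_monomial_eq_iff)
next
  case False
  then show ?thesis
    by (auto simp: star_form_def lookup_sum lookup_single when_def intro!: sum.neutral)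
qed

lemma star_form_in_forms:
  assumes "d \<ge> 2"
  shows "(star_form n d :: (nat, 'k::comm_ring_1) mpoly) \<in> forms n d"
proof -
  have "m \<in> form_monomials n d" if m: "m \<in> Poly_Mapping.keys (star_form n d :: (nat, 'k) mpoly)" for m
  proof -
    obtain l where l: "1 \<le> l" "l < n" "m = star_monomial d l"
      using m by (auto simp: in_keys_iff lookup_star_form split: if_splits)
    have keys: "Poly_Mapping.keys m \<subseteq> {0, l}"
      unfolding l star_monomial_def
      by (auto simp: in_keys_iff lookup_add lookup_single when_def split: if_splits)
    have "mono_degree m = (\<Sum>i\<in>{0, l}. Poly_Mapping.lookup m i)"
      unfolding mono_degree_def using keys
      by (intro sum.mono_neutral_left) (auto simp: in_keys_iff)
    also have "\<dots> = d"
      using l assms by (simp add: star_monomial_def lookup_add lookup_single when_def)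
    finally show ?thesis
      using keys l by (auto simp: form_monomials_def)
  qed
  then show ?thesis by (auto simp: forms_def)
qed

text \<open>Unique factorization for products of two variables. It singles out the Hessian positions
  that contribute at a fixed monomial.\<close>

lemma single_pair_eq_iff:
  "Poly_Mapping.single a (1::nat) + Poly_Mapping.single b 1
     = Poly_Mapping.single c 1 + Poly_Mapping.single e 1
   \<longleftrightarrow> a = c \<and> b = e \<or> a = e \<and> b = c" (is "?L = ?R \<longleftrightarrow> _")
proof
  assume "?L = ?R"
  then have "Poly_Mapping.lookup ?L a = Poly_Mapping.lookup ?R a"
    by simp
  then have "a = c \<or> a = e"
    by (auto simp: lookup_add lookup_single when_def split: if_splits)
  then show "a = c \<and> b = e \<or> a = e \<and> b = c"
    using \<open>?L = ?R\<close> by (metis add.commute add_left_cancel single_eq_iff one_neq_zero)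
qed (auto simp: add.commute)

lemma of_nat_nonzero_of_char:
  assumes "CHAR('k::semiring_1) = 0 \<or> CHAR('k) > d" "0 < r" "r \<le> d"
  shows "(of_nat r :: 'k) \<noteq> 0"
  using assms by (auto simp: of_nat_eq_0_iff_char_dvd dvd_imp_le dest: dvd_imp_le)

text \<open>The coefficient matrices \<open>B\<close> of the Hessian of \<open>star_form n d\<close> at the monomials
  \<open>x\<^sub>0\<^sup>d\<^sup>-\<^sup>3 x\<^sub>i\<close>, \<open>x\<^sub>0\<^sup>d\<^sup>-\<^sup>2\<close> and (for \<open>d \<ge> 4\<close>, \<open>n = 2\<close>) \<open>x\<^sub>0\<^sup>d\<^sup>-\<^sup>4 x\<^sub>1\<^sup>2\<close> are, up to nonzero factors,
  \<open>E\<^sub>0\<^sub>i + E\<^sub>i\<^sub>0\<close>, the sum of the \<open>E\<^sub>i\<^sub>i\<close> with \<open>i \<ge> 1\<close>, and \<open>E\<^sub>0\<^sub>0\<close>, where \<open>E\<^sub>i\<^sub>j\<close> are the matrix units.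
  Symmetry of \<open>B X\<close> for these \<open>B\<close> already forces \<open>X\<close> to be scalar.\<close>

lemma central_star_form:
  assumes d: "d \<ge> 3" and n: "n \<ge> 1" and nd: "(n, d) \<noteq> (2, 3)"
    and char: "CHAR('k::field) = 0 \<or> CHAR('k) > d"
  shows "central_form n (star_form n d :: (nat, 'k) mpoly)"
  unfolding central_form_iff[OF n]
proof (intro ballI allI impI)
  fix X :: "'k mat" and i j
  assume X: "X \<in> form_center n (star_form n d)" and ij: "i < n" "j < n"
  let ?h = "hess_coeff (Poly_Mapping.lookup (star_form n d :: (nat, 'k) mpoly))"
  let ?e = "\<lambda>i. Poly_Mapping.single i (1::nat)"
  have sym: "(\<Sum>k<n. ?h m p k * X $$ (k, q)) = (\<Sum>k<n. ?h m q k * X $$ (k, p))"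
    if "p < n" "q < n" for p q m
    using X that unfolding mem_form_center_iff by blast
  have h_sym: "?h m p q = ?h m q p" for m p q
    by (rule hess_coeff_sym)
  have single_term: "(\<Sum>k<n. ?h m p k * X $$ (k, q)) = ?h m p k0 * X $$ (k0, q)"
    if "k0 < n" "\<And>k. k < n \<Longrightarrow> k \<noteq> k0 \<Longrightarrow> ?h m p k = 0" for m p q k0
  proof -
    have "(\<Sum>k<n. ?h m p k * X $$ (k, q)) = (\<Sum>k\<in>{k0}. ?h m p k * X $$ (k, q))"
      using that by (intro sum.mono_neutral_right) auto
    then show ?thesis by simp
  qed
  have no_term: "(\<Sum>k<n. ?h m p k * X $$ (k, q)) = 0"
    if "\<And>k. k < n \<Longrightarrow> ?h m p k = 0" for m p q
    using that by simp
  have vanish: "?h m p q = 0" if "\<And>l. 1 \<le> l \<Longrightarrow> l < n \<Longrightarrow> m + ?e p + ?e q \<noteq> star_monomial d l" for m p q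
    using that by (auto simp: hess_coeff_def lookup_star_form)
  have coeff: "?h m p q = of_nat ((Poly_Mapping.lookup m p + 1) * (Poly_Mapping.lookup (m + ?e p) q + 1))"
    if "m + ?e p + ?e q = star_monomial d l" "1 \<le> l" "l < n" for m p q l
    using that by (auto simp: hess_coeff_def lookup_star_form)
  have nz: "(of_nat r :: 'k) \<noteq> 0" if "0 < r" "r \<le> d" for r
    using of_nat_nonzero_of_char[OF char that] .

  define m1 where "m1 i = Poly_Mapping.single 0 (d - 3) + ?e i" for i :: nat
  have m1_star: "m1 i + ?e 0 + ?e i = star_monomial d i" for i
  proof -
    have "m1 i + ?e 0 + ?e i = (Poly_Mapping.single 0 (d - 3) + ?e 0) + (?e i + ?e i)"
      by (simp add: m1_def add_ac)
    also have "\<dots> = star_monomial d i"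
      using d unfolding star_monomial_def single_add[symmetric]
      by (intro arg_cong2[where f = "(+)"] arg_cong2[where f = Poly_Mapping.single]) auto
    finally show ?thesis .
  qed
  have m1_zero: "?h (m1 i) p q = 0" if i: "1 \<le> i" and pq: "\<not> (p = 0 \<and> q = i \<or> p = i \<and> q = 0)" for i p q
  proof (rule vanish)
    fix l assume l: "1 \<le> l" "l < n"
    show "m1 i + ?e p + ?e q \<noteq> star_monomial d l"
    proof
      assume eq: "m1 i + ?e p + ?e q = star_monomial d l"
      \<comment> \<open>As \<open>i \<ge> 1\<close>, the variable \<open>i\<close> occurs in the
        star monomial only if \<open>l = i\<close>; cancelling \<open>m1 i\<close> then determines
        the pair \<open>p\<close>, \<open>q\<close>.\<close>
      have "Poly_Mapping.lookup (star_monomial d l) i \<ge> 1"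
        unfolding eq[symmetric] m1_def by (simp add: lookup_add)
      then have "l = i"
        using i by (auto simp: star_monomial_def lookup_add lookup_single when_def split: if_splits)
      with eq m1_star[of i] have "m1 i + (?e p + ?e q) = m1 i + (?e 0 + ?e i)"
        by (simp add: add.assoc)
      then show False
        using pq by (simp only: add_left_cancel single_pair_eq_iff)
    qed
  qed
  have m1_value: "?h (m1 i) 0 i = of_nat (d - 2) * of_nat 2" if "1 \<le> i" "i < n" for i
    using that d coeff[OF m1_star that]
    by (simp add: m1_def lookup_add lookup_single when_def Suc_diff_Suc numeral_2_eq_2 numeral_3_eq_3)
  have m1_nz: "?h (m1 i) 0 i \<noteq> 0" if "1 \<le> i" "i < n" for i
    unfolding m1_value[OF that] by (intro no_zero_divisors nz) (use d in auto)

  \<comment> \<open>Let \<open>B\<close> be the coefficient matrix at \<open>m1 i\<close>. The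
    entries \<open>(0, i)\<close> and \<open>(i, 0)\<close> of \<open>B X\<close> are the same
    nonzero multiple of \<open>X $$ (i, i)\<close> and \<open>X $$ (0, 0)\<close>.\<close>
  have diag: "X $$ (i, i) = X $$ (0, 0)" if i: "1 \<le> i" "i < n" for i
  proof -
    have "?h (m1 i) 0 i * X $$ (i, i) = ?h (m1 i) i 0 * X $$ (0, 0)"
      using sym[of 0 i "m1 i"] i m1_zero[OF i(1)]
        single_term[of i "m1 i" 0 i] single_term[of 0 "m1 i" i 0] by simp
    then show ?thesis
      using m1_nz[OF i] h_sym[of "m1 i" i 0] by simp
  qed
  \<comment> \<open>Row \<open>j\<close> of \<open>B\<close> is zero, while the entry
    \<open>(0, j)\<close> of \<open>B X\<close> is a nonzero multiple of
    \<open>X $$ (i, j)\<close>.\<close>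
  have off_diag: "X $$ (i, j) = 0" if ij: "1 \<le> i" "i < n" "1 \<le> j" "j < n" "i \<noteq> j" for i j
  proof -
    have "?h (m1 i) 0 i * X $$ (i, j) = 0"
      using sym[of 0 j "m1 i"] ij m1_zero[OF ij(1)]
        single_term[of i "m1 i" 0 j] no_term[of "m1 i" j 0] by simp
    then show ?thesis
      using m1_nz[OF ij(1,2)] by simp
  qed

  have first_row: "X $$ (0, j) = 0" if j: "1 \<le> j" "j < n" for j
  proof (cases "n \<ge> 3")
    case True
    \<comment> \<open>With \<open>i\<close> different from 0 and \<open>j\<close>, row
      \<open>j\<close> of \<open>B\<close> is zero, and the entry \<open>(i, j)\<close> of
      \<open>B X\<close> isolates \<open>X $$ (0, j)\<close>.\<close>
    obtain i where i: "1 \<le> i" "i < n" "i \<noteq> j"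
    proof (cases "j = 1")
      case True
      with \<open>n \<ge> 3\<close> show ?thesis by (intro that[of 2]) auto
    next
      case False
      with \<open>n \<ge> 3\<close> show ?thesis by (intro that[of 1]) auto
    qed
    have "?h (m1 i) i 0 * X $$ (0, j) = 0"
      using sym[of i j "m1 i"] i j m1_zero[OF i(1)]
        single_term[of 0 "m1 i" i j] no_term[of "m1 i" j i] by simp
    then show ?thesis
      using m1_nz[OF i(1,2)] h_sym[of "m1 i" i 0] by simp
  next
    case False
    \<comment> \<open>For \<open>n = 2\<close> there is no third index. Excluding
      \<open>(2, 3)\<close> gives \<open>d \<ge> 4\<close>, which makes room for a monomial whose
      only contribution is at position \<open>(0, 0)\<close>.\<close>
    with j nd d have n2: "n = 2" and d4: "d \<ge> 4" by auto
    define m where "m = Poly_Mapping.single 0 (d - 4) + Poly_Mapping.single (1::nat) 2"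
    have m_star: "m + ?e 0 + ?e 0 = star_monomial d 1"
    proof -
      have "m + ?e 0 + ?e 0
          = (Poly_Mapping.single 0 (d - 4) + ?e 0 + ?e 0) + Poly_Mapping.single 1 2"
        by (simp add: m_def add_ac)
      also have "\<dots> = star_monomial d 1"
        using d4 unfolding star_monomial_def single_add[symmetric]
        by (intro arg_cong2[where f = "(+)"] arg_cong2[where f = Poly_Mapping.single]) auto
      finally show ?thesis .
    qed
    have m_zero: "?h m p q = 0" if "\<not> (p = 0 \<and> q = 0)" for p q
    proof (rule vanish)
      fix l assume l: "1 \<le> l" "l < n"
      then have "l = 1" using n2 by simp
      show "m + ?e p + ?e q \<noteq> star_monomial d l"
      proof
        assume "m + ?e p + ?e q = star_monomial d l"
        with m_star \<open>l = 1\<close> have "m + (?e p + ?e q) = m + (?e 0 + ?e 0)"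
          by (simp add: add.assoc)
        then show False
          using that by (simp only: add_left_cancel single_pair_eq_iff) auto
      qed
    qed
    have "?h m 0 0
        = of_nat ((Poly_Mapping.lookup m 0 + 1) * (Poly_Mapping.lookup (m + ?e 0) 0 + 1))"
      by (intro coeff[OF m_star]) (use n2 in auto)
    moreover have "(Poly_Mapping.lookup m 0 + 1) * (Poly_Mapping.lookup (m + ?e 0) 0 + 1)
        = (d - 3) * (d - 2)"
      using d4 by (intro arg_cong2[where f = "(*)"])
        (auto simp: m_def lookup_add lookup_single when_def)
    moreover have "(of_nat ((d - 3) * (d - 2)) :: 'k) \<noteq> 0"
      unfolding of_nat_mult by (intro no_zero_divisors nz) (use d4 in auto)
    ultimately have "?h m 0 0 \<noteq> 0" by (simp only: not_False_eq_True)
    moreover have "?h m 0 0 * X $$ (0, j) = 0"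
      using sym[of 0 j m] j m_zero single_term[of 0 m 0 j] no_term[of m j 0] by simp
    ultimately show ?thesis by simp
  qed

  have first_col: "X $$ (i, 0) = 0" if i: "1 \<le> i" "i < n" for i
  proof -
    \<comment> \<open>At this monomial the coefficient matrix has 2 at each diagonal position except
      \<open>(0, 0)\<close>, and 0 elsewhere. Its row 0 vanishes, which leaves twice
      \<open>X $$ (i, 0)\<close> equal to 0.\<close>
    define m where "m = Poly_Mapping.single (0::nat) (d - 2)"
    have ee: "?e l + ?e l = Poly_Mapping.single l 2" for l :: nat
      unfolding single_add[symmetric] by (rule arg_cong[where f = "Poly_Mapping.single l"]) simp
    have m_star: "m + ?e l + ?e l = star_monomial d l" for l
      by (simp only: m_def star_monomial_def add.assoc ee)
    have m_zero: "?h m p q = 0" if "\<not> (p = q \<and> 1 \<le> p)" for p q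
    proof (rule vanish)
      fix l assume l: "1 \<le> l" "l < n"
      show "m + ?e p + ?e q \<noteq> star_monomial d l"
      proof
        assume "m + ?e p + ?e q = star_monomial d l"
        then have "m + (?e p + ?e q) = m + (?e l + ?e l)"
          using m_star[of l] by (simp only: add.assoc)
        then show False
          using that l by (simp only: add_left_cancel single_pair_eq_iff) auto
      qed
    qed
    have "?h m i i = of_nat 2"
      unfolding coeff[OF m_star i] using i by (simp add: m_def lookup_add lookup_single when_def)
    then have "?h m i i \<noteq> 0"
      using nz[of 2] d by simp
    moreover have "?h m i i * X $$ (i, 0) = 0"
      using sym[of i 0 m] i m_zero single_term[of i m i 0] no_term[of m 0 i] by simp
    ultimately show ?thesis by simp
  qed

  show "X $$ (i, j) = (if i = j then X $$ (0, 0) else 0)"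
    using diag[of i] off_diag[of i j] first_row[of j] first_col[of i] ij
    by (cases "i = 0"; cases "j = 0") auto
qed

section \<open>Density\<close>

text \<open>On the line, \<open>P\<close> and \<open>Q\<close> become univariate polynomials,
  nonzero by their values at \<open>t = 0\<close> and \<open>t = 1\<close>, so their product has
  finitely many roots.\<close>

lemma common_nonvanishing_on_line:
  fixes a b :: "'i \<Rightarrow> 'k::field"
  assumes "infinite (UNIV :: 'k set)" and "eval_mpoly a P \<noteq> 0" and "eval_mpoly b Q \<noteq> 0"
  shows "\<exists>t. eval_mpoly (\<lambda>i. a i + t * (b i - a i)) P \<noteq> 0 \<and>
             eval_mpoly (\<lambda>i. a i + t * (b i - a i)) Q \<noteq> 0"
proof -
  obtain p where p: "\<And>t. eval_mpoly (\<lambda>i. a i + t * (b i - a i)) P = poly p t"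
    using eval_mpoly_on_line[of a "\<lambda>i. b i - a i" P] by blast
  obtain q where q: "\<And>t. eval_mpoly (\<lambda>i. a i + t * (b i - a i)) Q = poly q t"
    using eval_mpoly_on_line[of a "\<lambda>i. b i - a i" Q] by blast
  have "p \<noteq> 0" using p[of 0] assms(2) by auto
  moreover have "q \<noteq> 0" using q[of 1] assms(3) by auto
  ultimately have "finite {t. poly (p * q) t = 0}"
    by (intro poly_roots_finite) simp
  then obtain t where "poly (p * q) t \<noteq> 0"
    using assms(1) by (metis (mono_tags, lifting) UNIV_eq_I mem_Collect_eq)
  then show ?thesis using p q by auto
qed

lemma form_on_line:
  fixes f g :: "(nat, 'k::comm_ring_1) mpoly"
  assumes "f \<in> forms n d" "g \<in> forms n d"
  shows "\<exists>h \<in> forms n d. Poly_Mapping.lookup h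
    = (\<lambda>m. Poly_Mapping.lookup f m + t * (Poly_Mapping.lookup g m - Poly_Mapping.lookup f m))"
proof (rule bexI)
  let ?h = "f + (g - f) * const_mpoly t"
  show lookup: "Poly_Mapping.lookup ?h
    = (\<lambda>m. Poly_Mapping.lookup f m + t * (Poly_Mapping.lookup g m - Poly_Mapping.lookup f m))"
    by (simp add: fun_eq_iff lookup_add lookup_minus lookup_mult_const_mpoly mult.commute[of t])
  show "?h \<in> forms n d"
    unfolding forms_def
  proof safe
    fix m assume "m \<in> Poly_Mapping.keys ?h"
    then have "m \<in> Poly_Mapping.keys f \<or> m \<in> Poly_Mapping.keys g"
      by (auto simp: in_keys_iff lookup)
    then show "m \<in> form_monomials n d"
      using assms by (auto simp: forms_def)
  qed
qed

theorem theorem3p2: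
  fixes n d :: nat
  assumes "d \<ge> 3" and "n \<ge> 1" and "(n, d) \<noteq> (2, 3)"
    and "CHAR('k::alg_closed_field) = 0 \<or> CHAR('k) > d"
  shows "openin (zariski_forms n d) {f \<in> forms n d :: (nat, 'k) mpoly set. central_form n f} \<and>
         zariski_forms n d closure_of {f \<in> forms n d :: (nat, 'k) mpoly set. central_form n f} = forms n d"
proof
  let ?C = "{f \<in> forms n d :: (nat, 'k) mpoly set. central_form n f}"
  \<comment> \<open>The largest admissible set of polynomials: nonvanishing of a member implies
    centrality by definition, and every central form has a member not vanishing at it.\<close>
  let ?S = "{P. \<forall>f :: (nat, 'k) mpoly. eval_mpoly (Poly_Mapping.lookup f) P \<noteq> 0 \<longrightarrow> central_form n f}"
  have "?C = forms n d - form_zero_locus n d ?S"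
    using central_form_neighbourhood[OF assms(2)] by (fastforce simp: form_zero_locus_def)
  then show "openin (zariski_forms n d) ?C"
    unfolding openin_zariski_forms by blast
  \<comment> \<open>Density: the required central form in \<open>U\<close> is found on the line from
    \<open>g\<close> to the star form.\<close>
  have "\<exists>h \<in> ?C. h \<in> U" if g: "g \<in> U" and U: "openin (zariski_forms n d) U"
    for g :: "(nat, 'k) mpoly" and U
  proof -
    obtain T where T: "U = forms n d - form_zero_locus n d T"
      using U unfolding openin_zariski_forms by blast
    then obtain Q where gf: "g \<in> forms n d" and Q: "Q \<in> T" "eval_mpoly (Poly_Mapping.lookup g) Q \<noteq> 0"
      using g by (auto simp: form_zero_locus_def)
    obtain P where P0: "eval_mpoly (Poly_Mapping.lookup (star_form n d :: (nat, 'k) mpoly)) P \<noteq> 0"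
      and P: "\<And>f. eval_mpoly (Poly_Mapping.lookup f) P \<noteq> 0 \<Longrightarrow> central_form n f"
      using central_form_neighbourhood[OF assms(2) central_star_form[OF assms]] by blast
    obtain t where t: "eval_mpoly (\<lambda>m. Poly_Mapping.lookup g m
          + t * (Poly_Mapping.lookup (star_form n d) m - Poly_Mapping.lookup g m)) Q \<noteq> 0"
        "eval_mpoly (\<lambda>m. Poly_Mapping.lookup g m
          + t * (Poly_Mapping.lookup (star_form n d) m - Poly_Mapping.lookup g m)) P \<noteq> 0"
      using common_nonvanishing_on_line[OF infinite_UNIV_alg_closed_field Q(2) P0] by blast
    have "(star_form n d :: (nat, 'k) mpoly) \<in> forms n d"
      using assms(1) by (intro star_form_in_forms) simp
    from form_on_line[OF gf this, of t] obtain h where h: "h \<in> forms n d"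
      "eval_mpoly (Poly_Mapping.lookup h) Q \<noteq> 0" "eval_mpoly (Poly_Mapping.lookup h) P \<noteq> 0"
      using t by auto
    then have "h \<in> ?C" "h \<in> U"
      using P Q(1) by (auto simp: T form_zero_locus_def)
    then show ?thesis by blast
  qed
  then show "zariski_forms n d closure_of ?C = forms n d"
    by (auto simp: closure_of_def topspace_zariski_forms)
qed

end
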